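(* Let $R=Q/P$ be a nonconstant rational function with $P,Q\in\mathbb{C}[z]$ coprime, and let $W=Q'P-QP'$. Then the affine inflection curve $\mathfrak{I}_R\subset\mathbb{C}$ is defined by the equation $$F_R(z,\bar z):=\frac{W(z)\,\overline{P(z)}^{\,2}-\overline{W(z)}\,P(z)^2}{2i}=0,$$ that is, $\mathfrak{I}_R=\{z\in\mathbb{C}: F_R(z,\bar z)=0\}$. In real coordinates $z=x+iy$, $F_R$ is a polynomial in $x,y$ with real coefficients.
   Context: For $R=Q/P$ as in the claim, the regular affine inflection locus is $\mathfrak{I}_R^{\mathrm{reg}}=\{z\in\mathbb{C}: R(z)\neq0,\ P(z)\neq0,\ \operatorname{Im}R'(z)=0\}$. The affine (algebraic) inflection curve $\mathfrak{I}_R$ is the closure of $\mathfrak{I}_R^{\mathrm{reg}}$ in $\mathbb{C}$. *)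

theory Defs
  imports "HOL-Complex_Analysis.Complex_Analysis" "HOL-Computational_Algebra.Polynomial_Factorial"
begin

text \<open>The rational function \<open>R = Q / P\<close> as a function on the complex numbers. It takes the junk
  value \<open>0\<close> at the zeros of \<open>P\<close>, so \<open>P z \<noteq> 0\<close> is demanded explicitly wherever this matters.\<close>

definition rat_fun :: "complex poly \<Rightarrow> complex poly \<Rightarrow> complex \<Rightarrow> complex" where
  "rat_fun Q P z = poly Q z / poly P z"

definition reg_inflection_locus :: "complex poly \<Rightarrow> complex poly \<Rightarrow> complex set" where
  "reg_inflection_locus Q P =
     {z. rat_fun Q P z \<noteq> 0 \<and> poly P z \<noteq> 0 \<and> Im (deriv (rat_fun Q P) z) = 0}"

definition inflection_curve :: "complex poly \<Rightarrow> complex poly \<Rightarrow> complex set" where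
  "inflection_curve Q P = closure (reg_inflection_locus Q P)"

definition wronskian :: "complex poly \<Rightarrow> complex poly \<Rightarrow> complex poly" where
  "wronskian Q P = pderiv Q * P - Q * pderiv P"

text \<open>\<open>inflection_form Q P z\<close> is the complex number \<open>F\<^sub>R(z, cnj z)\<close>.\<close>

definition inflection_form :: "complex poly \<Rightarrow> complex poly \<Rightarrow> complex \<Rightarrow> complex" where
  "inflection_form Q P z =
     (poly (wronskian Q P) z * (cnj (poly P z))\<^sup>2 - cnj (poly (wronskian Q P) z) * (poly P z)\<^sup>2)
       / (2 * \<i>)"

text \<open>Polynomials in two variables are represented as elements of \<open>K[x][y]\<close>: the outer
  variable is \<open>y\<close> and the coefficients are polynomials in \<open>x\<close>.\<close>

definition poly_eval2 :: "'a::comm_semiring_0 poly poly \<Rightarrow> 'a \<Rightarrow> 'a \<Rightarrow> 'a" where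
  "poly_eval2 p x y = poly (poly p [:y:]) x"

end

theory Submission
  imports Defs
begin

text \<open>Off the poles, \<open>R' = W / P\<^sup>2\<close>, hence \<open>F\<^sub>R = \<bar>P\<bar>\<^sup>4 Im R'\<close>. So the regular locus lies in the
  closed zero set of \<open>F\<^sub>R\<close> and misses only those zeros of \<open>F\<^sub>R\<close> at which \<open>Q\<close> or \<open>P\<close> vanishes.
  Near a zero of \<open>Q\<close> the open mapping theorem for \<open>R'\<close> produces further points with \<open>R'\<close> real;
  near a zero of \<open>P\<close> the function \<open>R'\<close> has a pole, and the same argument applies to \<open>1 / R'\<close>.\<close>

section \<open>The form \<open>F\<^sub>R\<close> and the derivative of \<open>R\<close>\<close>

text \<open>The two terms of the numerator are complex conjugates of each other, and
  \<open>w - cnj w\<close> is \<open>2 * \<i>\<close> times the imaginary part of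
  \<open>w\<close>.\<close>

lemma inflection_form_eq_Im:
  "inflection_form Q P z = complex_of_real (Im (poly (wronskian Q P) z * (cnj (poly P z))\<^sup>2))"
proof -
  define w where "w = poly (wronskian Q P) z * (cnj (poly P z))\<^sup>2"
  have "inflection_form Q P z = (w - cnj w) / (2 * \<i>)"
    by (simp add: inflection_form_def w_def)
  also have "\<dots> = complex_of_real (Im w)"
    by (simp add: complex_diff_cnj complex_eq_iff)
  finally show ?thesis by (simp add: w_def)
qed

lemma deriv_rat_fun:
  assumes "poly P z \<noteq> 0"
  shows "deriv (rat_fun Q P) z = poly (wronskian Q P) z / (poly P z)\<^sup>2"
proof -
  have "(rat_fun Q P has_field_derivative poly (wronskian Q P) z / (poly P z)\<^sup>2) (at z)"
    unfolding rat_fun_def [abs_def] using assms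
    by (auto intro!: derivative_eq_intros simp: wronskian_def power2_eq_square)
  then show ?thesis by (rule DERIV_imp_deriv)
qed

lemma inflection_form_eq_0_iff:
  assumes "poly P z \<noteq> 0"
  shows "inflection_form Q P z = 0 \<longleftrightarrow> Im (deriv (rat_fun Q P) z) = 0"
proof -
  let ?p = "poly P z" and ?w = "poly (wronskian Q P) z"
  \<comment> \<open>The factor \<open>cmod ?p ^ 4\<close> is real, so it can be pulled out of
    \<open>Im\<close>, and it is nonzero, so it can be cancelled.\<close>
  have "?w / ?p\<^sup>2 * complex_of_real (cmod ?p ^ 4) = ?w / ?p\<^sup>2 * (?p * cnj ?p)\<^sup>2"
    by (simp add: power2_eq_square numeral_eq_Suc flip: complex_norm_square)
  also have "\<dots> = ?w * (cnj ?p)\<^sup>2"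
    using assms by (simp add: power_mult_distrib)
  finally have "Im (?w * (cnj ?p)\<^sup>2) = Im (?w / ?p\<^sup>2) * cmod ?p ^ 4"
    by (metis Im_complex_of_real Re_complex_of_real add_0 mult_zero_right times_complex.sel(2))
  with assms show ?thesis
    by (simp add: inflection_form_eq_Im deriv_rat_fun)
qed

lemma holomorphic_rat_fun: "rat_fun Q P holomorphic_on {z. poly P z \<noteq> 0}"
  unfolding rat_fun_def [abs_def] by (auto intro!: holomorphic_intros)

lemma open_poly_nonzero: "open {z :: complex. poly P z \<noteq> 0}"
  by (intro open_Collect_neq continuous_intros)

lemma eventually_poly_nonzero:
  fixes P :: "complex poly"
  assumes "P \<noteq> 0"
  shows "\<forall>\<^sub>F z in at a. poly P z \<noteq> 0"
proof -
  have "\<not> a islimpt {z. poly P z = 0}"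
    using poly_roots_finite [OF assms] by (rule islimpt_finite)
  then show ?thesis by (simp add: islimpt_iff_eventually)
qed

section \<open>Real values of a function near a point or a pole\<close>

lemma holomorphic_exists_real_value:
  assumes "f holomorphic_on ball a r" "0 < r" "Im (f a) = 0"
  shows "\<exists>z\<in>ball a r - {a}. Im (f z) = 0"
proof (cases "f constant_on ball a r")
  case True
  have "a + of_real (r / 2) \<in> ball a r - {a}"
    using \<open>0 < r\<close> by (simp add: dist_norm)
  moreover have "f (a + of_real (r / 2)) = f a"
    using True calculation \<open>0 < r\<close> unfolding constant_on_def
    by (metis DiffD1 centre_in_ball)
  ultimately show ?thesis using assms(3) by metis
next
  case False
  have "open (f ` ball a r)"
    using open_mapping_thm [of f "ball a r" "ball a r"] assms False by auto
  moreover have "f a \<in> f ` ball a r"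
    using \<open>0 < r\<close> by simp
  ultimately obtain e where "e > 0" and e: "ball (f a) e \<subseteq> f ` ball a r"
    by (meson open_contains_ball)
  \<comment> \<open>A real shift keeps the value real and makes it differ from \<open>f a\<close>,
    so any preimage of it differs from \<open>a\<close>.\<close>
  have "f a + of_real (e / 2) \<in> ball (f a) e"
    using \<open>e > 0\<close> by (simp add: dist_norm)
  with e obtain z where z: "z \<in> ball a r" "f z = f a + of_real (e / 2)"
    by (metis imageE subsetD)
  with \<open>e > 0\<close> have "z \<noteq> a" by auto
  with z assms(3) show ?thesis by (intro bexI [of _ z]) auto
qed

text \<open>The previous lemma applies in arbitrarily small balls. Phrased with the filter
  \<open>at a\<close>, the result can be intersected with properties that hold eventually, such as
  avoiding the zeros of a polynomial.\<close>

lemma frequently_real_value: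
  assumes "f analytic_on {a}" "Im (f a) = 0"
  shows "\<exists>\<^sub>F z in at a. Im (f z) = 0"
proof (rule ccontr)
  assume "\<not> ?thesis"
  then have "\<forall>\<^sub>F z in at a. Im (f z) \<noteq> 0"
    by (simp add: not_frequently)
  then obtain d where d: "d > 0" "\<And>z. z \<noteq> a \<Longrightarrow> dist z a < d \<Longrightarrow> Im (f z) \<noteq> 0"
    by (auto simp: eventually_at)
  obtain r where "r > 0" "f holomorphic_on ball a r"
    using assms(1) by (auto simp: analytic_on_def)
  then have "f holomorphic_on ball a (min r d)"
    by (auto elim: holomorphic_on_subset)
  with holomorphic_exists_real_value [of f a "min r d"] \<open>r > 0\<close> d assms(2)
  show False by (auto simp: dist_commute)
qed

lemma frequently_real_value_at_pole:
  assumes "is_pole f a" "isolated_singularity_at f a"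
  shows "\<exists>\<^sub>F z in at a. Im (f z) = 0"
proof -
  \<comment> \<open>The value 0 removes the singularity of \<open>1 / f\<close> at the pole, and it
    is real, so the holomorphic case applies to \<open>g\<close>.\<close>
  define g where "g = (\<lambda>z. if z = a then 0 else inverse (f z))"
  obtain r where r: "r > 0" "f analytic_on ball a r - {a}"
    using assms(2) by (auto simp: isolated_singularity_at_def)
  have "\<forall>\<^sub>F z in at a. f z \<noteq> 0"
    using assms(1) by (rule non_zero_neighbour_pole)
  then obtain d where d: "d > 0" "\<And>z. z \<noteq> a \<Longrightarrow> dist z a < d \<Longrightarrow> f z \<noteq> 0"
    by (auto simp: eventually_at)
  let ?B = "ball a (min r d)"
  have "f holomorphic_on ?B - {a}"
    using r(2) by (auto intro: holomorphic_on_subset analytic_imp_holomorphic)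
  then have "g holomorphic_on ?B"
    unfolding g_def using assms(1) d
    by (intro is_pole_inverse_holomorphic) (auto simp: dist_commute)
  then have "g analytic_on {a}"
    using r(1) d(1) by (intro analytic_at[THEN iffD2] exI [of _ ?B]) auto
  then have "\<exists>\<^sub>F z in at a. Im (g z) = 0"
    by (rule frequently_real_value) (simp add: g_def)
  \<comment> \<open>Away from \<open>a\<close>, \<open>g\<close> is the inverse of \<open>f\<close>,
    and a complex number is real as soon as its inverse is.\<close>
  then have "\<exists>\<^sub>F z in at a. Im (g z) = 0 \<and> z \<noteq> a"
    by (rule frequently_eventually_frequently) (simp add: eventually_at_filter)
  then show ?thesis
    by (rule frequently_elim1) (auto simp: g_def)
qed

section \<open>Zeros of the form as limits of regular inflection points\<close>

lemma is_pole_rat_fun: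
  assumes "P \<noteq> 0" "poly P a = 0" "poly Q a \<noteq> 0"
  shows "is_pole (rat_fun Q P) a"
proof -
  have "filterlim (poly P) (at 0) (at a)"
    unfolding filterlim_at using assms eventually_poly_nonzero [OF assms(1)]
      isCont_def [of a "poly P"] by auto
  moreover have "(poly Q \<longlongrightarrow> poly Q a) (at a)"
    using isCont_def [of a "poly Q"] by simp
  ultimately show ?thesis
    unfolding is_pole_def rat_fun_def [abs_def] using assms(3)
    by (intro filterlim_divide_at_infinity) auto
qed

lemma frequently_real_deriv_rat_fun:
  assumes "P \<noteq> 0" "coprime P Q" "inflection_form Q P a = 0"
  shows "\<exists>\<^sub>F z in at a. Im (deriv (rat_fun Q P) z) = 0"
proof (cases "poly P a = 0")
  case False
  have "deriv (rat_fun Q P) analytic_on {a}"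
    using False open_poly_nonzero [of P] holomorphic_deriv [OF holomorphic_rat_fun]
    by (auto simp: analytic_at intro: exI [of _ "{z. poly P z \<noteq> 0}"])
  with False assms(3) show ?thesis
    by (intro frequently_real_value) (simp_all add: inflection_form_eq_0_iff)
next
  case True
  \<comment> \<open>Coprimality excludes a common zero, so \<open>a\<close> is a true pole of
    \<open>R\<close> rather than a removable singularity.\<close>
  with assms(2) have "poly Q a \<noteq> 0"
    using coprime_poly_0 by blast
  with True assms(1) have pole: "is_pole (rat_fun Q P) a"
    by (intro is_pole_rat_fun)
  obtain d where d: "d > 0" "\<And>z. z \<noteq> a \<Longrightarrow> dist z a < d \<Longrightarrow> poly P z \<noteq> 0"
    using eventually_poly_nonzero [OF assms(1), of a] by (auto simp: eventually_at)
  have hol: "rat_fun Q P holomorphic_on ball a d - {a}"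
    by (rule holomorphic_on_subset [OF holomorphic_rat_fun]) (auto simp: d(2) dist_commute)
  have iso: "isolated_singularity_at (rat_fun Q P) a"
    using d(1) hol unfolding isolated_singularity_at_def
    by (intro exI [of _ d]) (auto simp: analytic_on_open open_delete)
  show ?thesis
    using is_pole_deriv [OF pole iso] isolated_singularity_at_deriv [OF iso]
    by (rule frequently_real_value_at_pole)
qed

lemma closed_inflection_form_zeros: "closed {z. inflection_form Q P z = 0}"
  unfolding inflection_form_def by (intro closed_Collect_eq continuous_intros) auto

lemma inflection_curve_eq:
  assumes "P \<noteq> 0" "Q \<noteq> 0" "coprime P Q"
  shows "inflection_curve Q P = {z. inflection_form Q P z = 0}"
proof
  have "reg_inflection_locus Q P \<subseteq> {z. inflection_form Q P z = 0}"
    by (auto simp: reg_inflection_locus_def inflection_form_eq_0_iff)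
  then show "inflection_curve Q P \<subseteq> {z. inflection_form Q P z = 0}"
    unfolding inflection_curve_def by (intro closure_minimal closed_inflection_form_zeros)
  show "{z. inflection_form Q P z = 0} \<subseteq> inflection_curve Q P"
  proof
    fix a assume "a \<in> {z. inflection_form Q P z = 0}"
    then have "\<exists>\<^sub>F z in at a. Im (deriv (rat_fun Q P) z) = 0"
      using assms by (intro frequently_real_deriv_rat_fun) auto
    \<comment> \<open>\<open>P\<close> and \<open>Q\<close> have only finitely many zeros, so a
      punctured neighbourhood of \<open>a\<close> avoids them all and the real points found there
      are regular.\<close>
    then have "\<exists>\<^sub>F z in at a. Im (deriv (rat_fun Q P) z) = 0 \<and> (poly P z \<noteq> 0 \<and> poly Q z \<noteq> 0)"
      by (rule frequently_eventually_frequently)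
        (intro eventually_conj eventually_poly_nonzero assms)
    then have "\<exists>\<^sub>F z in at a. z \<in> reg_inflection_locus Q P"
      by (rule frequently_elim1) (auto simp: reg_inflection_locus_def rat_fun_def)
    then have "a islimpt reg_inflection_locus Q P"
      by (simp add: islimpt_conv_frequently_at)
    then show "a \<in> inflection_curve Q P"
      by (simp add: inflection_curve_def closure_def)
  qed
qed

section \<open>Polynomiality in real coordinates\<close>

text \<open>Tracking the real and imaginary parts together gives a class of complex-valued functions
  that is closed under conjugation, sums and products.\<close>

definition real_polynomial_parts :: "(complex \<Rightarrow> complex) \<Rightarrow> bool" where
  "real_polynomial_parts f \<longleftrightarrow> (\<exists>p q :: real poly poly. \<forall>x y.
     f (Complex x y) = Complex (poly_eval2 p x y) (poly_eval2 q x y))"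

lemma real_polynomial_partsI:
  assumes "\<And>x y. f (Complex x y) = Complex (poly_eval2 p x y) (poly_eval2 q x y)"
  shows "real_polynomial_parts f"
  using assms unfolding real_polynomial_parts_def by blast

lemma poly_eval2_simps [simp]:
  fixes p q :: "'a::comm_ring_1 poly poly"
  shows "poly_eval2 (p + q) x y = poly_eval2 p x y + poly_eval2 q x y"
    and "poly_eval2 (p - q) x y = poly_eval2 p x y - poly_eval2 q x y"
    and "poly_eval2 (- p) x y = - poly_eval2 p x y"
    and "poly_eval2 (p * q) x y = poly_eval2 p x y * poly_eval2 q x y"
    and "poly_eval2 [:[:c:]:] x y = c"
    and "poly_eval2 [:[:0, 1:]:] x y = x"
    and "poly_eval2 [:0, 1:] x y = y"
  by (simp_all add: poly_eval2_def)

lemma real_polynomial_parts_const: "real_polynomial_parts (\<lambda>_. c)"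
  by (rule real_polynomial_partsI [of _ "[:[:Re c:]:]" "[:[:Im c:]:]"]) simp

lemma real_polynomial_parts_ident: "real_polynomial_parts (\<lambda>z. z)"
  by (rule real_polynomial_partsI [of _ "[:[:0, 1:]:]" "[:0, 1:]"]) simp

lemma real_polynomial_parts_cnj:
  assumes "real_polynomial_parts f"
  shows "real_polynomial_parts (\<lambda>z. cnj (f z))"
proof -
  obtain p q where "\<And>x y. f (Complex x y) = Complex (poly_eval2 p x y) (poly_eval2 q x y)"
    using assms unfolding real_polynomial_parts_def by blast
  then show ?thesis
    by (intro real_polynomial_partsI [of _ p "- q"]) (simp add: complex_cnj)
qed

lemma real_polynomial_parts_add:
  assumes "real_polynomial_parts f" "real_polynomial_parts g"
  shows "real_polynomial_parts (\<lambda>z. f z + g z)"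
proof -
  obtain p q p' q' where
    "\<And>x y. f (Complex x y) = Complex (poly_eval2 p x y) (poly_eval2 q x y)"
    "\<And>x y. g (Complex x y) = Complex (poly_eval2 p' x y) (poly_eval2 q' x y)"
    using assms unfolding real_polynomial_parts_def by blast
  then show ?thesis
    by (intro real_polynomial_partsI [of _ "p + p'" "q + q'"]) (simp add: complex_eq_iff)
qed

lemma real_polynomial_parts_mult:
  assumes "real_polynomial_parts f" "real_polynomial_parts g"
  shows "real_polynomial_parts (\<lambda>z. f z * g z)"
proof -
  obtain p q p' q' where
    "\<And>x y. f (Complex x y) = Complex (poly_eval2 p x y) (poly_eval2 q x y)"
    "\<And>x y. g (Complex x y) = Complex (poly_eval2 p' x y) (poly_eval2 q' x y)"
    using assms unfolding real_polynomial_parts_def by blast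
  then show ?thesis
    \<comment> \<open>The witnesses are the real and imaginary parts of
      \<open>(p + \<i> q) (p' + \<i> q')\<close>.\<close>
    by (intro real_polynomial_partsI [of _ "p * p' - q * q'" "p * q' + q * p'"])
      (simp add: complex_eq_iff)
qed

lemma real_polynomial_parts_poly: "real_polynomial_parts (poly P)"
proof (induction P)
  case 0
  then show ?case using real_polynomial_parts_const [of 0] by (simp add: fun_eq_iff)
next
  case (pCons c P)
  then show ?case
    \<comment> \<open>Horner's rule: \<open>pCons c P\<close> evaluates to
      \<open>c + z * poly P z\<close>.\<close>
    using real_polynomial_parts_add [OF real_polynomial_parts_const
        real_polynomial_parts_mult [OF real_polynomial_parts_ident pCons.IH]]
    by (simp add: poly_pCons [abs_def])
qed

lemma inflection_form_real_polynomial: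
  "\<exists>p :: real poly poly. \<forall>x y :: real.
     inflection_form Q P (Complex x y) = complex_of_real (poly_eval2 p x y)"
proof -
  have "real_polynomial_parts (\<lambda>z. poly (wronskian Q P) z * (cnj (poly P z))\<^sup>2)"
    unfolding power2_eq_square
    by (intro real_polynomial_parts_mult real_polynomial_parts_cnj real_polynomial_parts_poly)
  \<comment> \<open>The form is the imaginary part of this product, so the second of the two real
    polynomials is the witness.\<close>
  then show ?thesis
    unfolding real_polynomial_parts_def inflection_form_eq_Im by (metis complex.sel(2))
qed

theorem proposition3p1:
  fixes P Q :: "complex poly"
  assumes "P \<noteq> 0"
    and "coprime P Q"
    and "\<not> rat_fun Q P constant_on {z. poly P z \<noteq> 0}"
  shows "inflection_curve Q P = {z. inflection_form Q P z = 0}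
    \<and> (\<exists>p :: real poly poly. \<forall>x y :: real.
          inflection_form Q P (Complex x y) = complex_of_real (poly_eval2 p x y))"
proof -
  \<comment> \<open>If \<open>Q\<close> were 0, \<open>R\<close> would be the constant 0.\<close>
  have "Q \<noteq> 0"
    using assms(3) by (auto simp: rat_fun_def constant_on_def)
  with assms show ?thesis
    using inflection_curve_eq inflection_form_real_polynomial by blast
qed

end
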